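(* Let $n$ be a positive integer and let $f:\mathbb E\to\mathbb R\cup\{+\infty\}$ be a function which has Fréchet derivatives $\nabla f(y),\nabla^2 f(y),\dots,\nabla^{n-1}f(y)$ at each point $y$ of some neighborhood of the point $x\in\mathbb E$, and suppose that the $n$-th order Fréchet derivative $\nabla^n f(x)$ exists. Then for every integer $m$ with $1\le m\le n$ the lower Hadamard derivatives of order $m$ at $x$ displayed below exist in every direction $u\in\mathbb E$, and the following relations hold: \[ f^{(1)}_-(x;u)=\nabla f(x)(u)\ \text{ for all } u\in\mathbb E,\qquad \partial^{(1)}_- f(x)=\{\nabla f(x)\}; \] \[ f^{(m)}_-(x;\nabla f(x),\nabla^2 f(x),\dots,\nabla^{m-1}f(x);u)=\nabla^m f(x)\underbrace{(u)\cdots(u)}_{m\text{ times}}\ \text{ for all } u\in\mathbb E,\quad m=2,3,\dots,n; \] \[ \nabla^m f(x)\in\partial^{(m)}_- f(x;\nabla f(x),\nabla^2 f(x),\dots,\nabla^{m-1}f(x)),\quad m=2,3,\dots,n. \]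
   Context: $\mathbb E$ is a real finite-dimensional Euclidean space. $L^1(\mathbb E)=L(\mathbb E,\mathbb R)$ is the space of continuous linear functionals on $\mathbb E$ and, for $n>1$, $L^n(\mathbb E)=L(\mathbb E,L^{n-1}(\mathbb E))$ is the space of continuous linear operators from $\mathbb E$ to $L^{n-1}(\mathbb E)$. Higher-order Fréchet derivatives are defined recursively: $\nabla^n f(x)\in L^n(\mathbb E)$ is the Fréchet derivative at $x$ of the map $\nabla^{n-1}f$. Possession of Fréchet derivatives at a point includes finiteness of $f$ near that point. A proper extended real function is $f:\mathbb E\to\mathbb R\cup\{+\infty\}$ having at least one finite value; $\mathrm{dom}\,f=\{x\mid f(x)<+\infty\}$. For $x\in\mathrm{dom}\,f$ and $u\in\mathbb E$, \[ f^{(1)}_-(x;u)=\liminf_{t\downarrow 0,\,u'\to u}t^{-1}[f(x+tu')-f(x)],\qquad \partial^{(1)}_-f(x)=\{x^*\in L^1(\mathbb E)\mid x^*(u)\le f^{(1)}_-(x;u)\ \forall u\in\mathbb E\}. \] Recursively, for $n>1$: given $x^*_i\in\partial^{(i)}_-f(x;x_1^*,\dots,x_{i-1}^* )$ for $i=1,\dots,n-1$ (for $i=1$ this means $x_1^*\in\partial^{(1)}_-f(x)$), the lower Hadamard derivative of order $n$ is \[ f^{(n)}_-(x;x_1^*,\dots,x_{n-1}^*;u)=\liminf_{t\downarrow0,\,u'\to u} n!\,t^{-n}\Big[f(x+tu')-f(x)-\sum_{i=1}^{n-1}\frac{t^i}{i!}\,x_i^*\underbrace{(u')\cdots(u')}_{i\text{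 times}}\Big]\in[-\infty,+\infty], \] and it is defined (exists) only for such $x_i^*$. The lower Hadamard subdifferential of order $n$ is \[ \partial^{(n)}_-f(x;x_1^*,\dots,x_{n-1}^* )=\{x^*\in L^n(\mathbb E)\mid x^*\underbrace{(u)\cdots(u)}_{n\text{ times}}\le f^{(n)}_-(x;x_1^*,\dots,x_{n-1}^*;u)\ \forall u\in\mathbb E\}. \] *)

theory Defs
  imports "HOL-Analysis.Analysis"
begin

text \<open>
  HOL has no type depending on \<open>n\<close>, so the iterated spaces \<open>L\<^sup>n(E) = L(E, L\<^sup>n\<^sup>-\<^sup>1(E))\<close>, with
  \<open>L\<^sup>0(E)\<close> the reals, are carriers in the single type of functionals on lists:
  the value \<open>A(u\<^sub>1)\<dots>(u\<^sub>n)\<close> is written \<open>A [u\<^sub>1, \<dots>, u\<^sub>n]\<close>, and an element of \<open>L\<^sup>n(E)\<close> vanishes on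
  lists of any other length, so that equality in \<open>L\<^sup>n(E)\<close> is equality of HOL functions.
\<close>

type_synonym 'a form = "'a list \<Rightarrow> real"

definition form_app :: "'a form \<Rightarrow> 'a \<Rightarrow> 'a form" where
  "form_app A u = (\<lambda>us. A (u # us))"

text \<open>The iterated operator norm; the successor case has the shape of \<^const>\<open>onorm\<close>.\<close>

primrec form_norm :: "nat \<Rightarrow> 'a::real_normed_vector form \<Rightarrow> real" where
  "form_norm 0 A = \<bar>A []\<bar>"
| "form_norm (Suc n) A = (SUP u. form_norm n (form_app A u) / norm u)"

text \<open>
  The last two conjuncts of the successor case say that \<open>u \<mapsto> A(u)\<close> is linear and bounded
  (hence continuous) as a map into \<open>L\<^sup>n(E)\<close>.
\<close>

primrec Lspace :: "nat \<Rightarrow> 'a::real_normed_vector form set" where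
  "Lspace 0 = {A. \<forall>us. us \<noteq> [] \<longrightarrow> A us = 0}"
| "Lspace (Suc n) = {A. A [] = 0 \<and> (\<forall>u. form_app A u \<in> Lspace n)
      \<and> (\<forall>us. linear (\<lambda>u. form_app A u us))
      \<and> (\<exists>K. \<forall>u. form_norm n (form_app A u) \<le> norm u * K)}"

text \<open>\<open>A \<in> L\<^sup>n\<^sup>+\<^sup>1(E)\<close> is the Frechet derivative at \<open>x\<close> of a map \<open>G\<close> into \<open>L\<^sup>n(E)\<close>.\<close>

definition has_form_derivative ::
    "nat \<Rightarrow> ('a::real_normed_vector \<Rightarrow> 'a form) \<Rightarrow> 'a form \<Rightarrow> 'a \<Rightarrow> bool" where
  "has_form_derivative n G A x \<longleftrightarrow> A \<in> Lspace (Suc n) \<and>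
     ((\<lambda>y. form_norm n (\<lambda>us. G y us - G x us - form_app A (y - x) us) / norm (y - x)) \<longlongrightarrow> 0) (at x)"

primrec nabla :: "nat \<Rightarrow> ('a::real_normed_vector \<Rightarrow> ereal) \<Rightarrow> 'a \<Rightarrow> 'a form" where
  "nabla 0 f = (\<lambda>x us. if us = [] then real_of_ereal (f x) else 0)"
| "nabla (Suc n) f = (\<lambda>x. THE A. has_form_derivative n (nabla n f) A x)"

text \<open>At order 1 this is the library's derivative.\<close>

lemma has_form_derivative_0_iff:
  "has_form_derivative 0 (nabla 0 f) A x \<longleftrightarrow>
     (\<forall>us. length us \<noteq> 1 \<longrightarrow> A us = 0) \<and>
     ((\<lambda>y. real_of_ereal (f y)) has_derivative (\<lambda>u. A [u])) (at x)"
proof -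
  have len: "(A [] = 0 \<and> (\<forall>u us. us \<noteq> [] \<longrightarrow> A (u # us) = 0))
      \<longleftrightarrow> (\<forall>us. length us \<noteq> 1 \<longrightarrow> A us = 0)" (is "?l \<longleftrightarrow> ?r")
  proof
    assume ?l
    then show ?r
      by (metis length_Cons list.size(3) neq_Nil_conv One_nat_def)
  qed auto
  have lin: "(\<forall>us. linear (\<lambda>u. A (u # us))) \<longleftrightarrow> linear (\<lambda>u. A [u])"
    if "\<forall>u us. us \<noteq> [] \<longrightarrow> A (u # us) = 0"
  proof
    assume l: "linear (\<lambda>u. A [u])"
    show "\<forall>us. linear (\<lambda>u. A (u # us))"
    proof
      fix us show "linear (\<lambda>u. A (u # us))"
        using l that by (cases "us = []") (auto simp: linear_iff)
    qed
  qed blast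
  have bl: "A \<in> Lspace (Suc 0) \<longleftrightarrow>
      (\<forall>us. length us \<noteq> 1 \<longrightarrow> A us = 0) \<and> bounded_linear (\<lambda>u. A [u])"
    using len lin
    by (auto simp: form_app_def bounded_linear_def bounded_linear_axioms_def)
  have lim: "((\<lambda>y. \<bar>g y\<bar> / norm (y - x)) \<longlongrightarrow> 0) (at x) \<longleftrightarrow>
      ((\<lambda>y. g y /\<^sub>R norm (y - x)) \<longlongrightarrow> 0) (at x)" for g :: "'a \<Rightarrow> real"
    by (subst (2) tendsto_rabs_zero_iff[symmetric]) (simp add: abs_mult divide_inverse mult.commute)
  have eq: "((\<lambda>y. real_of_ereal (f y)) has_derivative (\<lambda>u. A [u])) (at x) \<longleftrightarrow>
      bounded_linear (\<lambda>u. A [u]) \<and>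
      ((\<lambda>y. (real_of_ereal (f y) - real_of_ereal (f x) - A [y - x]) /\<^sub>R norm (y - x)) \<longlongrightarrow> 0) (at x)"
    by (simp add: has_derivative_at_within)
  show ?thesis
    unfolding has_form_derivative_def bl eq
    using lim[of "\<lambda>y. real_of_ereal (f y) - real_of_ereal (f x) - A [y - x]"]
    by (auto simp: form_app_def)
qed

text \<open>
  Existence of \<^term>\<open>nabla n f x\<close>. Each order requires the previous one on a whole
  neighbourhood of the point; in particular order 1 includes finiteness of \<open>f\<close> near the point.
\<close>

primrec nabla_exists :: "nat \<Rightarrow> ('a::real_normed_vector \<Rightarrow> ereal) \<Rightarrow> 'a \<Rightarrow> bool" where
  "nabla_exists 0 f = (\<lambda>x. \<bar>f x\<bar> \<noteq> \<infinity>)"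
| "nabla_exists (Suc n) f = (\<lambda>x. (\<forall>\<^sub>F y in nhds x. nabla_exists n f y) \<and>
      (\<exists>A. has_form_derivative n (nabla n f) A x))"

definition edom :: "('a \<Rightarrow> ereal) \<Rightarrow> 'a set" where
  "edom f = {x. f x < \<infinity>}"

text \<open>
  The functionals \<open>x\<^sub>1\<^sup>*, x\<^sub>2\<^sup>*, \<dots>\<close> are given by \<open>X 1, X 2, \<dots>\<close>; at order \<open>n\<close> only
  \<open>X 1, \<dots>, X (n - 1)\<close> are used, and none at order 1. The lower limit is over \<open>t > 0\<close>, \<open>t \<rightarrow> 0\<close>
  and \<open>u' \<rightarrow> u\<close>, with \<open>u' = u\<close> allowed.
\<close>

definition hadamard_deriv ::
    "nat \<Rightarrow> ('a::real_normed_vector \<Rightarrow> ereal) \<Rightarrow> 'a \<Rightarrow> (nat \<Rightarrow> 'a form) \<Rightarrow> 'a \<Rightarrow> ereal" where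
  "hadamard_deriv n f x X u =
     Liminf (at_right 0 \<times>\<^sub>F nhds u)
       (\<lambda>(t::real, u'). ereal (fact n / t ^ n) *
          (f (x + t *\<^sub>R u') - f x
             - ereal (\<Sum>i\<in>{1..<n}. t ^ i / fact i * X i (replicate i u'))))"

definition hadamard_subdiff ::
    "nat \<Rightarrow> ('a::real_normed_vector \<Rightarrow> ereal) \<Rightarrow> 'a \<Rightarrow> (nat \<Rightarrow> 'a form) \<Rightarrow> 'a form set" where
  "hadamard_subdiff n f x X =
     {A \<in> Lspace n. \<forall>u. ereal (A (replicate n u)) \<le> hadamard_deriv n f x X u}"

text \<open>
  The two constants above are total functions; the order-\<open>n\<close> derivative is meaningful
  only at points of the domain and for successively chosen subgradients.
\<close>

definition hadamard_deriv_exists ::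
    "nat \<Rightarrow> ('a::real_normed_vector \<Rightarrow> ereal) \<Rightarrow> 'a \<Rightarrow> (nat \<Rightarrow> 'a form) \<Rightarrow> bool" where
  "hadamard_deriv_exists n f x X \<longleftrightarrow>
     x \<in> edom f \<and> (\<forall>i\<in>{1..<n}. X i \<in> hadamard_subdiff i f x X)"

end

theory Submission imports Defs begin

text \<open>
  The heart of the matter is Taylor's formula with Peano's remainder: if \<open>\<nabla>\<^sup>m f(x)\<close> exists, then
  \<open>f(x + h) = (\<Sum>i\<le>m. \<nabla>\<^sup>i f(x)(h)\<dots>(h) / i!) + o(\<parallel>h\<parallel>\<^sup>m)\<close> (lemma \<open>taylor_peano\<close>). For \<open>h = t u'\<close> the
  difference quotient defining the lower Hadamard derivative of order \<open>m\<close> at the arguments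
  \<open>\<nabla> f(x), \<dots>, \<nabla>\<^sup>m\<^sup>-\<^sup>1 f(x)\<close> therefore equals \<open>\<nabla>\<^sup>m f(x)(u')\<dots>(u') + o(1) \<parallel>u'\<parallel>\<^sup>m\<close>. Since \<open>\<nabla>\<^sup>m f(x)\<close>
  is a continuous form, the quotient has a genuine limit as \<open>t\<close> decreases to \<open>0\<close> and \<open>u' \<rightarrow> u\<close>,
  and its lower limit is \<open>\<nabla>\<^sup>m f(x)(u)\<dots>(u)\<close> (lemma \<open>hadamard_deriv_nabla\<close>). So the defining
  inequality of the subdifferential holds for \<open>\<nabla>\<^sup>m f(x)\<close>, with equality. As \<open>f\<close>
  is finite at \<open>x\<close>, existence at order \<open>m\<close> amounts to this membership at all lower orders. At order \<open>1\<close> a subgradient is a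
  linear functional below the linear functional \<open>\<nabla> f(x)\<close>, hence equal to it.

  Taylor's formula reduces to one real variable. On the segment from \<open>x\<close> to \<open>x + h\<close>, the \<open>j\<close>-th
  derivative of \<open>s \<mapsto> f(x + s h)\<close> is \<open>\<nabla>\<^sup>j f(x + s h)(h)\<dots>(h)\<close> for \<open>j < m\<close>, since each
  differentiation in \<open>s\<close> fills one more slot with \<open>h\<close>. As \<open>\<nabla>\<^sup>m f\<close> is given at \<open>x\<close> only, the
  Lagrange form is used at order \<open>m - 1\<close>, after subtracting the expected term of order \<open>m\<close>
  (lemma \<open>taylor_top_increment_bound\<close>); the differentiability of \<open>\<nabla>\<^sup>m\<^sup>-\<^sup>1 f\<close> at \<open>x\<close> in the operator
  norm then bounds the remainder uniformly in the direction of \<open>h\<close>.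
\<close>

section \<open>Forms and the iterated operator norm\<close>

lemma Lspace_eq_0: "A \<in> Lspace n \<Longrightarrow> length us \<noteq> n \<Longrightarrow> A us = 0"
proof (induction n arbitrary: A us)
  case (Suc n)
  show ?case
  proof (cases us)
    case (Cons u vs)
    then have "form_app A u vs = 0" using Suc by auto
    then show ?thesis using Cons by (simp add: form_app_def)
  qed (use Suc in auto)
qed auto

lemma Lspace_form_app: "A \<in> Lspace (Suc n) \<Longrightarrow> form_app A u \<in> Lspace n"
  by simp

lemma Lspace_linear: "A \<in> Lspace (Suc n) \<Longrightarrow> linear (\<lambda>u. A (u # us))"
  by (simp add: form_app_def)

text \<open>
  A real supremum carries information only over a set that is bounded above; membership in
  \<^const>\<open>Lspace\<close> provides this.
\<close>

lemma form_norm_bdd_above: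
  assumes "A \<in> Lspace (Suc n)"
  shows "bdd_above (range (\<lambda>u. form_norm n (form_app A u) / norm u))"
proof -
  obtain K where K: "form_norm n (form_app A u) \<le> norm u * K" for u using assms by auto
  have "form_norm n (form_app A u) / norm u \<le> \<bar>K\<bar>" for u
  proof (cases "u = 0")
    case False
    have "form_norm n (form_app A u) \<le> norm u * \<bar>K\<bar>"
      by (rule order_trans[OF K]) (simp add: mult_left_mono)
    then show ?thesis using False by (simp add: field_simps)
  qed simp
  then show ?thesis by (auto simp: bdd_above_def)
qed

lemma form_norm_quotient_le:
  "A \<in> Lspace (Suc n) \<Longrightarrow> form_norm n (form_app A u) / norm u \<le> form_norm (Suc n) A"
  using cSUP_upper[OF UNIV_I form_norm_bdd_above] by simp

lemma form_bound:
  "A \<in> Lspace n \<Longrightarrow> length us = n \<Longrightarrow> \<bar>A us\<bar> \<le> form_norm n A * prod_list (map norm us)"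
proof (induction n arbitrary: A us)
  case (Suc n)
  then obtain u vs where us: "us = u # vs" "length vs = n" by (cases us) auto
  show ?case
  proof (cases "u = 0")
    case True
    then show ?thesis using linear_0[OF Lspace_linear[OF Suc.prems(1)], of vs] us by simp
  next
    case False
    have le: "form_norm n (form_app A u) \<le> form_norm (Suc n) A * norm u"
      using form_norm_quotient_le[OF Suc.prems(1), of u] False by (simp add: divide_le_eq)
    have "0 \<le> prod_list (map norm vs)" by (induction vs) auto
    note mult_right_mono[OF le this]
    moreover have "\<bar>A us\<bar> \<le> form_norm n (form_app A u) * prod_list (map norm vs)"
      using Suc.IH[OF Lspace_form_app[OF Suc.prems(1)] us(2), of u] us(1)
      by (simp add: form_app_def)
    ultimately show ?thesis using us by (simp add: mult.assoc)
  qed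
qed auto

text \<open>
  The triangle inequality and closure under differences need each other: the supremum at order
  \<open>n + 1\<close> is taken over differences of forms of order \<open>n\<close>, and the operator bound that makes a
  difference an element of \<^const>\<open>Lspace\<close> is the triangle inequality one order below.
\<close>

lemma Lspace_diff_and_form_norm_triangle:
  "A \<in> Lspace n \<Longrightarrow> B \<in> Lspace n \<Longrightarrow>
    (\<lambda>us. A us - B us) \<in> Lspace n \<and>
    form_norm n (\<lambda>us. A us - B us) \<le> form_norm n A + form_norm n B"
proof (induction n arbitrary: A B)
  case (Suc n)
  have app: "form_app (\<lambda>us. A us - B us) u = (\<lambda>us. form_app A u us - form_app B u us)" for u
    by (simp add: form_app_def)
  have IH: "form_app (\<lambda>us. A us - B us) u \<in> Lspace n"
    "form_norm n (form_app (\<lambda>us. A us - B us) u)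
      \<le> form_norm n (form_app A u) + form_norm n (form_app B u)" for u
    using Suc.IH[OF Suc.prems[THEN Lspace_form_app], of u u] unfolding app by auto
  obtain K L where KL: "form_norm n (form_app A u) \<le> norm u * K"
    "form_norm n (form_app B u) \<le> norm u * L" for u
    using Suc.prems by auto
  have "form_norm n (form_app (\<lambda>us. A us - B us) u) \<le> norm u * (K + L)" for u
    using IH(2)[of u] KL[of u] by (simp add: algebra_simps)
  moreover have "linear (\<lambda>u. form_app (\<lambda>us. A us - B us) u us)" for us
    using linear_compose_sub[OF Suc.prems[THEN Lspace_linear, of us]] by (simp add: form_app_def)
  ultimately have "(\<lambda>us. A us - B us) \<in> Lspace (Suc n)"
    using IH(1) Suc.prems by auto
  moreover have "form_norm (Suc n) (\<lambda>us. A us - B us) \<le> form_norm (Suc n) A + form_norm (Suc n) B"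
    unfolding form_norm.simps(2)[of n "\<lambda>us. A us - B us"]
  proof (rule cSUP_least)
    fix u
    have "form_norm n (form_app (\<lambda>us. A us - B us) u) / norm u
        \<le> form_norm n (form_app A u) / norm u + form_norm n (form_app B u) / norm u"
      using divide_right_mono[OF IH(2) norm_ge_zero, of u u] by (simp add: add_divide_distrib)
    also have "\<dots> \<le> form_norm (Suc n) A + form_norm (Suc n) B"
      by (intro add_mono form_norm_quotient_le Suc.prems)
    finally show "form_norm n (form_app (\<lambda>us. A us - B us) u) / norm u
        \<le> form_norm (Suc n) A + form_norm (Suc n) B" .
  qed simp
  ultimately show ?case by blast
qed auto

lemma Lspace_diff: "A \<in> Lspace n \<Longrightarrow> B \<in> Lspace n \<Longrightarrow> (\<lambda>us. A us - B us) \<in> Lspace n"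
  using Lspace_diff_and_form_norm_triangle by blast

lemma form_replicate_scaleR:
  "A \<in> Lspace n \<Longrightarrow> A (replicate n (t *\<^sub>R u)) = t ^ n * A (replicate n u)"
proof (induction n arbitrary: A)
  case (Suc n)
  have "A (replicate (Suc n) (t *\<^sub>R u)) = t * form_app A u (replicate n (t *\<^sub>R u))"
    using linear_scale[OF Lspace_linear[OF Suc.prems]] by (simp add: form_app_def)
  also have "\<dots> = t ^ Suc n * A (replicate (Suc n) u)"
    using Suc.IH[OF Lspace_form_app[OF Suc.prems], of u] by (simp add: form_app_def)
  finally show ?case .
qed auto

text \<open>
  In an orthonormal basis \<open>A(u)\<dots>(u)\<close> is a polynomial in the coordinates of \<open>u\<close>; expanding one slot
  at a time reduces the order.
\<close>

lemma continuous_on_form_replicate: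
  fixes A :: "'a::euclidean_space form"
  shows "A \<in> Lspace n \<Longrightarrow> continuous_on UNIV (\<lambda>u. A (replicate n u))"
proof (induction n arbitrary: A)
  case (Suc n)
  have "A (u # us) = (\<Sum>b\<in>Basis. (u \<bullet> b) * form_app A b us)" for u us
  proof -
    have "A (u # us) = A ((\<Sum>b\<in>Basis. (u \<bullet> b) *\<^sub>R b) # us)"
      by (simp add: euclidean_representation)
    also have "\<dots> = (\<Sum>b\<in>Basis. A ((u \<bullet> b) *\<^sub>R b # us))"
      by (rule linear_sum[OF Lspace_linear[OF Suc.prems]])
    also have "\<dots> = (\<Sum>b\<in>Basis. (u \<bullet> b) * form_app A b us)"
      using linear_scale[OF Lspace_linear[OF Suc.prems, of us]] by (simp add: form_app_def)
    finally show ?thesis .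
  qed
  then have "(\<lambda>u. A (replicate (Suc n) u))
      = (\<lambda>u. \<Sum>b\<in>Basis. (u \<bullet> b) * form_app A b (replicate n u))"
    by simp
  then show ?case
    by (rule ssubst) (intro continuous_intros Suc.IH Lspace_form_app Suc.prems)
qed auto

section \<open>Derivatives of form-valued maps and the iterated gradient\<close>

text \<open>
  Convergence in the operator norm implies convergence at each list of arguments; this brings in
  the ordinary calculus of real-valued functions, in particular the uniqueness of derivatives.
\<close>

lemma has_form_derivative_imp_has_derivative:
  assumes der: "has_form_derivative n G A x"
    and near: "\<forall>\<^sub>F y in nhds x. G y \<in> Lspace n" and len: "length us = n"
  shows "((\<lambda>y. G y us) has_derivative (\<lambda>u. A (u # us))) (at x)"
proof -
  have A: "A \<in> Lspace (Suc n)" using der by (simp add: has_form_derivative_def)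
  let ?D = "\<lambda>y us. G y us - G x us - form_app A (y - x) us"
  let ?c = "prod_list (map norm us)"
  have x: "G x \<in> Lspace n" using near by (rule eventually_nhds_x_imp_x)
  have lim: "((\<lambda>y. form_norm n (?D y) / norm (y - x) * ?c) \<longlongrightarrow> 0) (at x)"
    using der unfolding has_form_derivative_def by (intro tendsto_mult_left_zero) simp
  have "\<forall>\<^sub>F y in at x. norm (?D y us /\<^sub>R norm (y - x)) \<le> form_norm n (?D y) / norm (y - x) * ?c"
    using near[unfolded eventually_nhds_conv_at, THEN conjunct1]
  proof eventually_elim
    case (elim y)
    then have "?D y \<in> Lspace n" using x A by (intro Lspace_diff) simp_all
    then have "\<bar>?D y us\<bar> / norm (y - x) \<le> form_norm n (?D y) * ?c / norm (y - x)"
      by (intro divide_right_mono form_bound len) simp_all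
    then show ?case by (simp add: field_simps)
  qed
  then have "((\<lambda>y. ?D y us /\<^sub>R norm (y - x)) \<longlongrightarrow> 0) (at x)"
    using lim by (rule Lim_null_comparison)
  moreover have "bounded_linear (\<lambda>u. A (u # us))"
    using linear_add[OF Lspace_linear[OF A]] linear_scale[OF Lspace_linear[OF A]]
      form_bound[OF A, of "_ # us"] len
    by (intro bounded_linear_intro[of _ "form_norm (Suc n) A * ?c"])
      (simp_all del: form_norm.simps add: mult_ac)
  ultimately show ?thesis
    by (simp add: has_derivative_at_within form_app_def)
qed

lemma has_form_derivative_unique:
  assumes A: "has_form_derivative n G A x" and B: "has_form_derivative n G B x"
    and near: "\<forall>\<^sub>F y in nhds x. G y \<in> Lspace n"
  shows "A = B"
proof
  fix us
  show "A us = B us"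
  proof (cases "length us = Suc n")
    case True
    then obtain u vs where us: "us = u # vs" and len: "length vs = n" by (cases us) auto
    have "(\<lambda>u. A (u # vs)) = (\<lambda>u. B (u # vs))"
      by (rule has_derivative_unique[OF
            has_form_derivative_imp_has_derivative[OF A near len]
            has_form_derivative_imp_has_derivative[OF B near len]])
    then show ?thesis using us by metis
  next
    case False
    have "A \<in> Lspace (Suc n)" "B \<in> Lspace (Suc n)"
      using A B unfolding has_form_derivative_def by blast+
    then show ?thesis using Lspace_eq_0 False by metis
  qed
qed

text \<open>
  Uniqueness makes the definite description in \<^const>\<open>nabla\<close> denote the derivative, and it needs
  values in \<^const>\<open>Lspace\<close> near the point, which come from the same statement one order below:
  hence the joint induction.
\<close>

lemma nabla_in_Lspace_and_has_form_derivative: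
  "nabla_exists n f x \<Longrightarrow> nabla n f x \<in> Lspace n \<and>
    (\<forall>k. n = Suc k \<longrightarrow> has_form_derivative k (nabla k f) (nabla n f x) x)"
proof (induction n arbitrary: x)
  case (Suc k)
  then obtain A where A: "has_form_derivative k (nabla k f) A x" by auto
  have "\<forall>\<^sub>F y in nhds x. nabla k f y \<in> Lspace k"
    using Suc.prems by (auto elim!: eventually_mono dest: Suc.IH)
  then have "B = A" if "has_form_derivative k (nabla k f) B x" for B
    using has_form_derivative_unique[OF that A] by blast
  with A have "has_form_derivative k (nabla k f) (nabla (Suc k) f x) x"
    unfolding nabla.simps(2) by (rule theI)
  then show ?case unfolding has_form_derivative_def by simp
qed simp

lemma nabla_in_Lspace: "nabla_exists n f x \<Longrightarrow> nabla n f x \<in> Lspace n"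
  by (simp add: nabla_in_Lspace_and_has_form_derivative)

lemma nabla_has_form_derivative:
  "nabla_exists (Suc n) f x \<Longrightarrow> has_form_derivative n (nabla n f) (nabla (Suc n) f x) x"
  using nabla_in_Lspace_and_has_form_derivative by blast

lemma nabla_exists_Suc_near: "nabla_exists (Suc n) f x \<Longrightarrow> \<forall>\<^sub>F y in nhds x. nabla_exists n f y"
  by simp

lemma nabla_exists_le: "m \<le> n \<Longrightarrow> nabla_exists n f x \<Longrightarrow> nabla_exists m f x"
  by (induction n rule: dec_induct) (auto dest: eventually_nhds_x_imp_x)

lemma nabla_has_derivative:
  assumes "nabla_exists (Suc n) f x" "length us = n"
  shows "((\<lambda>y. nabla n f y us) has_derivative (\<lambda>u. nabla (Suc n) f x (u # us))) (at x)"
proof (rule has_form_derivative_imp_has_derivative)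
  show "has_form_derivative n (nabla n f) (nabla (Suc n) f x) x"
    by (rule nabla_has_form_derivative[OF assms(1)])
  show "\<forall>\<^sub>F y in nhds x. nabla n f y \<in> Lspace n"
    using nabla_exists_Suc_near[OF assms(1)] by (rule eventually_mono) (rule nabla_in_Lspace)
qed (rule assms(2))

lemma nabla_along_segment_has_derivative:
  assumes "nabla_exists (Suc j) f (x + s *\<^sub>R h)"
  shows "((\<lambda>s. nabla j f (x + s *\<^sub>R h) (replicate j h)) has_real_derivative
    nabla (Suc j) f (x + s *\<^sub>R h) (replicate (Suc j) h)) (at s)"
proof -
  let ?D = "\<lambda>u. nabla (Suc j) f (x + s *\<^sub>R h) (u # replicate j h)"
  have "linear ?D"
    using nabla_in_Lspace[OF assms] by (rule Lspace_linear)
  then have D: "?D (t *\<^sub>R h) = t * ?D h" for t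
    using linear_scale by fastforce
  have "((\<lambda>s. x + s *\<^sub>R h) has_derivative (\<lambda>t. t *\<^sub>R h)) (at s)"
    by (auto intro!: derivative_eq_intros)
  then have "((\<lambda>s. nabla j f (x + s *\<^sub>R h) (replicate j h)) has_derivative (\<lambda>t. ?D (t *\<^sub>R h))) (at s)"
    by (rule has_derivative_compose) (rule nabla_has_derivative[OF assms], simp)
  then show ?thesis
    unfolding D has_field_derivative_def by (simp add: mult.commute[of _ "?D h"] del: nabla.simps)
qed

section \<open>Taylor's formula with Peano's remainder\<close>

text \<open>
  After the term \<open>c s\<^sup>k\<^sup>+\<^sup>1 / (k + 1)!\<close> is subtracted, the derivatives of order below \<open>k\<close> at \<open>0\<close> are
  unchanged, while the \<open>k\<close>-th one differs from its value at \<open>0\<close> by at most \<open>B\<close>. The Lagrange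
  remainder of order \<open>k\<close> of the difference is therefore the \<open>k\<close>-th Taylor term up to \<open>B\<close>.
\<close>

lemma taylor_top_increment_bound:
  fixes g :: "nat \<Rightarrow> real \<Rightarrow> real"
  assumes der: "\<And>j s. j < k \<Longrightarrow> \<bar>s\<bar> \<le> 1 \<Longrightarrow> (g j has_real_derivative g (Suc j) s) (at s)"
    and top: "\<And>s. \<bar>s\<bar> \<le> 1 \<Longrightarrow> \<bar>g k s - g k 0 - s * c\<bar> \<le> B"
  shows "\<bar>g 0 1 - (\<Sum>j\<le>k. g j 0 / fact j) - c / fact (Suc k)\<bar> \<le> B"
proof -
  define p where "p j s = g j s - s ^ (Suc k - j) / fact (Suc k - j) * c" for j s
  have "(p j has_real_derivative p (Suc j) s) (at s)" if "j < k" "\<bar>s\<bar> \<le> 1" for j s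
  proof -
    define r where "r = k - j"
    then have r: "Suc k - j = Suc r" "Suc k - Suc j = r"
      using that(1) by (simp_all add: Suc_diff_le)
    have "((\<lambda>s. s ^ Suc r / fact (Suc r) * c) has_real_derivative
        real (Suc r) * s ^ r / fact (Suc r) * c) (at s)"
      by (rule DERIV_cmult_right[OF DERIV_cdivide[OF DERIV_pow[of "Suc r" s, unfolded diff_Suc_Suc diff_zero]]])
    also have "real (Suc r) * s ^ r / fact (Suc r) * c = s ^ r / fact r * c"
      unfolding fact_Suc of_nat_mult by (simp del: of_nat_Suc)
    finally have "((\<lambda>s. g j s - s ^ Suc r / fact (Suc r) * c) has_real_derivative
        g (Suc j) s - s ^ r / fact r * c) (at s)"
      by (rule DERIV_diff[OF der[OF that]])
    then show ?thesis
      unfolding p_def[abs_def] r .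
  qed
  then obtain s where s: "\<bar>s\<bar> \<le> 1"
    and eq: "p 0 1 = (\<Sum>j<k. p j 0 / fact j) + p k s / fact k"
    using Maclaurin_bi_le[of p "p 0" k 1] by auto
  have "(\<Sum>j<k. p j 0 / fact j) = (\<Sum>j<k. g j 0 / fact j)"
    by (intro sum.cong) (auto simp: p_def)
  then have "g 0 1 - (\<Sum>j\<le>k. g j 0 / fact j) - c / fact (Suc k)
      = (g k s - g k 0 - s * c) / fact k"
    using eq by (simp add: p_def lessThan_Suc_atMost[symmetric] diff_divide_distrib)
  also have "\<bar>\<dots>\<bar> \<le> \<bar>g k s - g k 0 - s * c\<bar>"
    using mult_left_mono[OF fact_ge_1, of "\<bar>g k s - g k 0 - s * c\<bar>" k]
    by (simp add: divide_le_eq)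
  also have "\<dots> \<le> B" by (rule top[OF s])
  finally show ?thesis .
qed

definition taylor_remainder ::
    "nat \<Rightarrow> ('a::real_normed_vector \<Rightarrow> ereal) \<Rightarrow> 'a \<Rightarrow> 'a \<Rightarrow> real" where
  "taylor_remainder n f x h =
    real_of_ereal (f (x + h)) - (\<Sum>i\<le>n. nabla i f x (replicate i h) / fact i)"

text \<open>
  The bound needed at the top order is \<open>\<bar>(\<nabla>\<^sup>k f(x + s h) - \<nabla>\<^sup>k f(x) - \<nabla>\<^sup>k\<^sup>+\<^sup>1 f(x)(s h))(h)\<dots>(h)\<bar> \<le> e \<parallel>h\<parallel>\<^sup>k\<^sup>+\<^sup>1\<close>:
  differentiability of \<open>\<nabla>\<^sup>k f\<close> at \<open>x\<close> gives the factor \<open>e \<parallel>s h\<parallel> \<le> e \<parallel>h\<parallel>\<close> in the operator norm, and the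
  \<open>k\<close> arguments \<open>h\<close> give \<open>\<parallel>h\<parallel>\<^sup>k\<close>.
\<close>

lemma taylor_remainder_bound:
  assumes ex: "nabla_exists (Suc k) f x" and "e > 0"
  shows "\<forall>\<^sub>F h in nhds 0. \<bar>taylor_remainder (Suc k) f x h\<bar> \<le> e * norm h ^ Suc k"
proof -
  define A where "A = nabla (Suc k) f x"
  define D where "D y = (\<lambda>us. nabla k f y us - nabla k f x us - form_app A (y - x) us)" for y
  have A: "A \<in> Lspace (Suc k)" unfolding A_def by (rule nabla_in_Lspace[OF ex])
  have "((\<lambda>y. form_norm k (D y) / norm (y - x)) \<longlongrightarrow> 0) (at x)"
    using nabla_has_form_derivative[OF ex] unfolding has_form_derivative_def D_def A_def by blast
  then have "\<forall>\<^sub>F y in at x. \<bar>form_norm k (D y) / norm (y - x)\<bar> < e"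
    using \<open>e > 0\<close> by (auto simp: tendsto_iff)
  then have "\<forall>\<^sub>F y in nhds x. y \<noteq> x \<longrightarrow> \<bar>form_norm k (D y) / norm (y - x)\<bar> < e"
    by (simp add: eventually_at_filter)
  with nabla_exists_Suc_near[OF ex]
  have "\<forall>\<^sub>F y in nhds x. nabla_exists k f y \<and>
      (y \<noteq> x \<longrightarrow> \<bar>form_norm k (D y) / norm (y - x)\<bar> < e)"
    by (rule eventually_conj)
  then obtain d where "d > 0" and near: "\<And>y. dist y x < d \<Longrightarrow> nabla_exists k f y"
    and small: "\<And>y. dist y x < d \<Longrightarrow> y \<noteq> x \<Longrightarrow> \<bar>form_norm k (D y) / norm (y - x)\<bar> < e"
    unfolding eventually_nhds_metric by blast
  have "\<bar>taylor_remainder (Suc k) f x h\<bar> \<le> e * norm h ^ Suc k" if h: "norm h < d" for h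
  proof -
    let ?u = "\<lambda>j. replicate j h"
    define g where "g j s = nabla j f (x + s *\<^sub>R h) (?u j)" for j s
    have seg: "dist (x + s *\<^sub>R h) x < d" if "\<bar>s\<bar> \<le> 1" for s
      using mult_right_mono[OF that norm_ge_zero, of h] h by (simp add: dist_norm)
    have der: "(g j has_real_derivative g (Suc j) s) (at s)" if "j < k" "\<bar>s\<bar> \<le> 1" for j s
      unfolding g_def using that
      by (intro nabla_along_segment_has_derivative nabla_exists_le[of "Suc j" k] near seg) auto
    have top: "\<bar>g k s - g k 0 - s * A (?u (Suc k))\<bar> \<le> e * norm h ^ Suc k" if s: "\<bar>s\<bar> \<le> 1" for s
    proof (cases "s *\<^sub>R h = 0")
      case True
      then have "s * A (?u (Suc k)) = 0"
        using form_replicate_scaleR[OF A, of 0 h] by auto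
      moreover have "g k s = g k 0" by (simp only: g_def True scaleR_zero_left)
      ultimately have "g k s - g k 0 - s * A (?u (Suc k)) = 0" by linarith
      then show ?thesis using \<open>e > 0\<close> by (simp only:) simp
    next
      case False
      let ?y = "x + s *\<^sub>R h"
      have "form_norm k (D ?y) \<le> e * norm (s *\<^sub>R h)"
        using small[OF seg[OF s]] False by (simp add: abs_less_iff divide_less_eq)
      also have "\<dots> \<le> e * norm h"
        using mult_right_mono[OF s norm_ge_zero, of h] \<open>e > 0\<close> by (intro mult_left_mono) auto
      finally have norm_le: "form_norm k (D ?y) \<le> e * norm h" .
      have "D ?y \<in> Lspace k"
        unfolding D_def
        by (intro Lspace_diff nabla_in_Lspace near seg s Lspace_form_app A) (use \<open>d > 0\<close> in simp)
      then have "\<bar>D ?y (?u k)\<bar> \<le> form_norm k (D ?y) * prod_list (map norm (?u k))"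
        by (rule form_bound) simp
      also have "\<dots> \<le> e * norm h * norm h ^ k"
        using norm_le by (simp add: prod_list_replicate mult_right_mono)
      also have "D ?y (?u k) = g k s - g k 0 - s * A (?u (Suc k))"
        using linear_scale[OF Lspace_linear[OF A, of "?u k"], of s h]
        by (simp add: D_def g_def form_app_def)
      finally show ?thesis by (simp add: mult.assoc)
    qed
    from taylor_top_increment_bound[of k g, OF der top]
    show ?thesis by (simp add: taylor_remainder_def g_def A_def diff_diff_eq)
  qed
  then show ?thesis using \<open>d > 0\<close> by (auto simp: eventually_nhds_metric dist_norm)
qed

lemma taylor_peano:
  assumes ex: "nabla_exists (Suc k) f x"
  obtains r where "(r \<longlongrightarrow> 0) (nhds 0)"
    and "\<And>h. taylor_remainder (Suc k) f x h = r h * norm h ^ Suc k"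
proof
  let ?R = "taylor_remainder (Suc k) f x"
  define r where "r h = ?R h / norm h ^ Suc k" for h
  \<comment> \<open>At \<open>h = 0\<close> the quotient is \<open>0\<close> by convention, so the identity there needs \<open>?R 0 = 0\<close>.\<close>
  have "\<bar>?R 0\<bar> \<le> 0"
    using eventually_nhds_x_imp_x[OF taylor_remainder_bound[OF ex zero_less_one]] by simp
  then show "?R h = r h * norm h ^ Suc k" for h
    by (cases "h = 0") (auto simp: r_def)
  show "(r \<longlongrightarrow> 0) (nhds 0)"
  proof (rule tendstoI)
    fix e :: real assume "e > 0"
    then have "\<forall>\<^sub>F h in nhds 0. \<bar>?R h\<bar> \<le> e / 2 * norm h ^ Suc k"
      by (intro taylor_remainder_bound[OF ex]) simp
    then show "\<forall>\<^sub>F h in nhds 0. dist (r h) 0 < e"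
    proof eventually_elim
      case (elim h)
      then have "\<bar>r h\<bar> \<le> e / 2"
        using \<open>e > 0\<close> by (cases "h = 0") (auto simp: r_def divide_le_eq)
      then show ?case using \<open>e > 0\<close> by simp
    qed
  qed
qed

section \<open>Hadamard derivatives of differentiable functions\<close>

text \<open>
  Near \<open>(0, u)\<close> the argument \<open>x + t u'\<close> is close to \<open>x\<close>, where \<open>f\<close> is finite, so the extended real
  quotient is a real one and Taylor's formula applies to it. Continuity of \<open>\<nabla>\<^sup>m f(x)\<close> absorbs the
  variation of \<open>u'\<close>, and the lower limit is a limit.
\<close>

lemma hadamard_deriv_nabla:
  fixes f :: "'a::euclidean_space \<Rightarrow> ereal"
  assumes ex: "nabla_exists m f x" and "m \<ge> 1"
  shows "hadamard_deriv m f x (\<lambda>i. nabla i f x) u = ereal (nabla m f x (replicate m u))"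
proof -
  obtain k where m: "m = Suc k" using \<open>m \<ge> 1\<close> by (cases m) auto
  let ?F = "\<lambda>y. real_of_ereal (f y)"
  let ?c = "\<lambda>i v. nabla i f x (replicate i v)"
  let ?filter = "at_right (0::real) \<times>\<^sub>F nhds u"
  obtain r where r0: "(r \<longlongrightarrow> 0) (nhds 0)"
    and r: "\<And>h. taylor_remainder m f x h = r h * norm h ^ m"
    by (rule taylor_peano[OF ex[unfolded m], folded m]) (rule that)
  have t: "((\<lambda>p. fst p) \<longlongrightarrow> 0) ?filter"
    by (rule filterlim_mono[OF filterlim_fst _ order_refl]) (simp add: at_within_le_nhds)
  have v: "((\<lambda>p. snd p) \<longlongrightarrow> u) ?filter" by (rule filterlim_snd)
  have h: "((\<lambda>p. fst p *\<^sub>R snd p) \<longlongrightarrow> 0) ?filter"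
    using tendsto_scaleR[OF t v] by simp
  then have "((\<lambda>p. x + fst p *\<^sub>R snd p) \<longlongrightarrow> x) ?filter"
    using tendsto_add[OF tendsto_const] by fastforce
  moreover have "\<forall>\<^sub>F y in nhds x. \<bar>f y\<bar> \<noteq> \<infinity>"
    using nabla_exists_Suc_near[OF ex[unfolded m]]
    by (rule eventually_mono) (use nabla_exists_le[of 0 k f] in simp)
  ultimately have fin: "\<forall>\<^sub>F p in ?filter. \<bar>f (x + fst p *\<^sub>R snd p)\<bar> \<noteq> \<infinity>"
    by (auto simp: filterlim_iff)
  have pos: "\<forall>\<^sub>F p in ?filter. fst p > 0"
    using filterlim_fst[of "at_right (0::real)" "nhds u"] eventually_at_right_less[of "0::real"]
    by (auto simp: filterlim_iff)
  have finx: "ereal (?F x) = f x"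
    using nabla_exists_le[OF _ ex, of 0] by (simp add: ereal_real')
  \<comment> \<open>The Taylor terms of order \<open>1, \<dots>, m - 1\<close> cancel; the top term and the remainder survive.\<close>
  have quotient: "fact m / t ^ m * (?F (x + t *\<^sub>R v) - ?F x - (\<Sum>i\<in>{1..<m}. t ^ i / fact i * ?c i v))
      = ?c m v + fact m * r (t *\<^sub>R v) * norm v ^ m" if "t > 0" for t v
  proof -
    have hom: "?c i (t *\<^sub>R v) = t ^ i * ?c i v" if "i \<le> m" for i
      by (intro form_replicate_scaleR nabla_in_Lspace nabla_exists_le[OF that ex])
    have "(\<Sum>i\<le>m. ?c i (t *\<^sub>R v) / fact i) = (\<Sum>i\<le>m. t ^ i / fact i * ?c i v)"
      by (intro sum.cong) (auto simp: hom)
    also have "\<dots> = ?F x + (\<Sum>i\<in>{1..<m}. t ^ i / fact i * ?c i v) + t ^ m / fact m * ?c m v"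
    proof -
      have "{..m} = insert 0 (insert m {1..<m})" using \<open>m \<ge> 1\<close> by auto
      then show ?thesis using \<open>m \<ge> 1\<close> by simp
    qed
    finally have "?F (x + t *\<^sub>R v) - ?F x - (\<Sum>i\<in>{1..<m}. t ^ i / fact i * ?c i v)
        = t ^ m / fact m * ?c m v + r (t *\<^sub>R v) * (t ^ m * norm v ^ m)"
      using r[of "t *\<^sub>R v"] that by (simp add: taylor_remainder_def power_mult_distrib)
    also have "fact m / t ^ m * \<dots> = ?c m v + fact m * r (t *\<^sub>R v) * norm v ^ m"
      using that by (simp add: field_simps)
    finally show ?thesis .
  qed
  have cont: "((\<lambda>p. ?c m (snd p)) \<longlongrightarrow> ?c m u) ?filter"
    using continuous_on_form_replicate[OF nabla_in_Lspace[OF ex]] v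
    by (rule continuous_on_tendsto_compose) auto
  have "((\<lambda>p. ?c m (snd p) + fact m * r (fst p *\<^sub>R snd p) * norm (snd p) ^ m)
      \<longlongrightarrow> ?c m u + fact m * 0 * norm u ^ m) ?filter"
    by (intro tendsto_intros cont v filterlim_compose[OF r0 h])
  then have "((\<lambda>p. ereal (?c m (snd p) + fact m * r (fst p *\<^sub>R snd p) * norm (snd p) ^ m))
      \<longlongrightarrow> ereal (?c m u)) ?filter"
    by simp
  moreover have "\<forall>\<^sub>F p in ?filter.
      ereal (?c m (snd p) + fact m * r (fst p *\<^sub>R snd p) * norm (snd p) ^ m)
      = (case p of (t, v) \<Rightarrow> ereal (fact m / t ^ m) * (f (x + t *\<^sub>R v) - f x
          - ereal (\<Sum>i\<in>{1..<m}. t ^ i / fact i * ?c i v)))"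
    using fin pos
  proof eventually_elim
    case (elim p)
    obtain t v where p: "p = (t, v)" by (cases p)
    have "ereal (?c m v + fact m * r (t *\<^sub>R v) * norm v ^ m)
        = ereal (fact m / t ^ m) * (ereal (?F (x + t *\<^sub>R v)) - ereal (?F x)
          - ereal (\<Sum>i\<in>{1..<m}. t ^ i / fact i * ?c i v))"
      unfolding ereal_minus times_ereal.simps by (subst quotient) (use elim(2) p in simp_all)
    also have "ereal (?F (x + t *\<^sub>R v)) = f (x + t *\<^sub>R v)"
      using elim(1) p by (simp add: ereal_real')
    also note finx
    finally show ?case by (simp only: p split fst_conv snd_conv)
  qed
  ultimately have "((\<lambda>(t, v). ereal (fact m / t ^ m) * (f (x + t *\<^sub>R v) - f x
      - ereal (\<Sum>i\<in>{1..<m}. t ^ i / fact i * ?c i v))) \<longlongrightarrow> ereal (?c m u)) ?filter"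
    by (rule Lim_transform_eventually)
  then show ?thesis
    unfolding hadamard_deriv_def
    by (intro lim_imp_Liminf) (simp_all add: prod_filter_eq_bot)
qed

lemma nabla_in_hadamard_subdiff:
  fixes f :: "'a::euclidean_space \<Rightarrow> ereal"
  assumes "nabla_exists m f x" "m \<ge> 1"
  shows "nabla m f x \<in> hadamard_subdiff m f x (\<lambda>i. nabla i f x)"
  unfolding hadamard_subdiff_def hadamard_deriv_nabla[OF assms]
  using nabla_in_Lspace[OF assms(1)] by blast

text \<open>
  Linear functionals \<open>A \<le> B\<close> agree, since the inequality at \<open>- u\<close> is the reverse one at \<open>u\<close>.
\<close>

lemma Lspace_1_le_imp_eq:
  assumes A: "A \<in> Lspace 1" and B: "B \<in> Lspace 1" and le: "\<And>u. A [u] \<le> B [u]"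
  shows "A = B"
proof
  fix us
  have neg: "A [- u] = - A [u]" "B [- u] = - B [u]" for u
    using linear_neg[OF Lspace_linear[of _ 0 "[]"]] A B by auto
  show "A us = B us"
  proof (cases "length us = 1")
    case True
    then obtain u where "us = [u]" by (auto simp: length_Suc_conv)
    then show ?thesis using le[of u] le[of "- u"] neg[of u] by simp
  qed (use Lspace_eq_0 A B in metis)
qed

lemma hadamard_subdiff_1_eq_nabla:
  fixes f :: "'a::euclidean_space \<Rightarrow> ereal"
  assumes ex: "nabla_exists 1 f x"
  shows "hadamard_subdiff 1 f x (\<lambda>i. nabla i f x) = {nabla 1 f x}"
proof -
  have "A = nabla 1 f x" if "A \<in> hadamard_subdiff 1 f x (\<lambda>i. nabla i f x)" for A
  proof (rule Lspace_1_le_imp_eq)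
    show "A \<in> Lspace 1" using that unfolding hadamard_subdiff_def by blast
    show "nabla 1 f x \<in> Lspace 1" by (rule nabla_in_Lspace[OF ex])
    show "A [u] \<le> nabla 1 f x [u]" for u
    proof -
      have "ereal (A (replicate 1 u)) \<le> hadamard_deriv 1 f x (\<lambda>i. nabla i f x) u"
        using that unfolding hadamard_subdiff_def by blast
      then have "ereal (A (replicate 1 u)) \<le> ereal (nabla 1 f x (replicate 1 u))"
        unfolding hadamard_deriv_nabla[OF ex order_refl] .
      then show ?thesis by simp
    qed
  qed
  then show ?thesis using nabla_in_hadamard_subdiff[OF ex order_refl] by blast
qed

theorem theorem2p1:
  fixes f :: "'a::euclidean_space \<Rightarrow> ereal" and x :: 'a and n :: nat
  assumes "n \<ge> 1"
    and "\<And>y. f y \<noteq> -\<infinity>"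
    and "\<forall>\<^sub>F y in nhds x. \<forall>k\<in>{1..n-1}. nabla_exists k f y"
    and "nabla_exists n f x"
  shows "(\<forall>m\<in>{1..n}. hadamard_deriv_exists m f x (\<lambda>i. nabla i f x))
    \<and> (\<forall>u. hadamard_deriv 1 f x (\<lambda>i. nabla i f x) u = ereal (nabla 1 f x [u]))
    \<and> hadamard_subdiff 1 f x (\<lambda>i. nabla i f x) = {nabla 1 f x}
    \<and> (\<forall>m\<in>{2..n}. \<forall>u. hadamard_deriv m f x (\<lambda>i. nabla i f x) u
          = ereal (nabla m f x (replicate m u)))
    \<and> (\<forall>m\<in>{2..n}. nabla m f x \<in> hadamard_subdiff m f x (\<lambda>i. nabla i f x))"
proof -
  have ex: "nabla_exists m f x" if "m \<le> n" for m
    using nabla_exists_le[OF that] assms(4) .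
  have "x \<in> edom f" using ex[of 0] by (auto simp: edom_def less_top[symmetric])
  moreover have sub: "nabla m f x \<in> hadamard_subdiff m f x (\<lambda>i. nabla i f x)"
    if "m \<in> {1..n}" for m
    using that by (intro nabla_in_hadamard_subdiff ex) auto
  ultimately have "\<forall>m\<in>{1..n}. hadamard_deriv_exists m f x (\<lambda>i. nabla i f x)"
    by (auto simp: hadamard_deriv_exists_def)
  moreover have "hadamard_deriv m f x (\<lambda>i. nabla i f x) u = ereal (nabla m f x (replicate m u))"
    if "m \<in> {1..n}" for m u
    using that by (intro hadamard_deriv_nabla ex) auto
  moreover from this[of 1]
  have "\<forall>u. hadamard_deriv 1 f x (\<lambda>i. nabla i f x) u = ereal (nabla 1 f x [u])"
    using assms(1) by simp
  moreover note hadamard_subdiff_1_eq_nabla[OF ex[OF assms(1)]]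
  ultimately show ?thesis using sub by (simp del: One_nat_def)
qed

end
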